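(* Let $q\in(0,\infty)$, let $(\mathcal{X},\rho,\mu)$ be a quasi-metric measure space, let $\Omega\subseteq\mathcal{X}$ be a bounded measurable set (i.e. $\sup_{x,y\in\Omega}\rho(x,y)<\infty$), let $Y(\mathcal{X})$ be a ball quasi-Banach function space, and let $Y(\Omega)$ be the restriction of $Y(\mathcal{X})$ to $\Omega$. Then, for every $f\in\bigcup_{s\in(0,1)}\dot{W}^{s,q}_Y(\Omega)$, $$\lim_{s\to0^+}s^{\frac1q}\left\|\left\{\int_\Omega\frac{|f(\cdot)-f(y)|^q}{U(\cdot,y)[\rho(\cdot,y)]^{sq}}\,d\mu(y)\right\}^{\frac1q}\right\|_{Y(\Omega)}=0.$$
   Context: A quasi-metric on a nonempty set $\mathcal{X}$ is a function $\rho:\mathcal{X}\times\mathcal{X}\to[0,\infty)$ with $\rho(x,y)=0$ iff $x=y$, $\rho(x,y)=\rho(y,x)$, and $\rho(x,z)\le K_0[\rho(x,y)+\rho(y,z)]$ for all $x,y,z$, for some constant $K_0\in[1,\infty)$. Balls are $B(x,r):=\{y\in\mathcal{X}:\rho(x,y)<r\}$. A quasi-metric measure space $(\mathcal{X},\rho,\mu)$ is a quasi-metric space with a nonnegative measure $\mu$ defined on a $\sigma$-algebra containing all balls. Put $U(x,y):=\min\{\mu(B(x,\rho(x,y))),\mu(B(y,\rho(x,y)))\}$. The integrand $|f(x)-f(y)|^q/(U(x,y)[\rho(x,y)]^{sq})$ is read as $0$ at $y=x$. $\mathscr{M}(\mathcal{X})$ (resp. $\mathscr{M}(\Omega)$)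 is the set of $\mu$-measurable functions on $\mathcal{X}$ (resp. $\Omega$). A ball quasi-Banach function space $Y(\mathcal{X})$ is a quasi-Banach space of functions in $\mathscr{M}(\mathcal{X})$ whose quasi-norm $\|\cdot\|_{Y(\mathcal{X})}$ makes sense (with values in $[0,\infty]$) for all $f\in\mathscr{M}(\mathcal{X})$, and such that: (i) $\|f\|_{Y(\mathcal{X})}=0$ implies $f=0$ $\mu$-a.e.; (ii) $|g|\le|f|$ $\mu$-a.e. implies $\|g\|_{Y(\mathcal{X})}\le\|f\|_{Y(\mathcal{X})}$; (iii) $0\le f_m\uparrow f$ $\mu$-a.e. implies $\|f_m\|_{Y(\mathcal{X})}\uparrow\|f\|_{Y(\mathcal{X})}$; (iv) $\mathbf{1}_B\in Y(\mathcal{X})$ for every ball $B$. For measurable $\Omega\subseteq\mathcal{X}$, $Y(\Omega):=\{f\in\mathscr{M}(\Omega): f=g|_\Omega\text{ for some }g\in Y(\mathcal{X})\}$ with $\|f\|_{Y(\Omega)}:=\inf\{\|g\|_{Y(\mathcal{X})}:g\in Y(\mathcal{X}),\ g|_\Omega=f\}$ (and $\|f\|_{Y(\Omega)}=\infty$ if no such $g$ exists). For $s\in(0,1)$, $\dot{W}^{s,q}_Y(\Omega)$ is the set of all measurable $f$ on $\Omega$ with $\big\|\{\int_\Omega\frac{|f(\cdot)-f(y)|^q}{U(\cdot,y)[\rho(\cdot,y)]^{sq}}\,d\mu(y)\}^{1/q}\big\|_{Y(\Omega)}<\infty$. The notation $s\to0^+$ means $s\in(0,1)$, $s\to0$.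
   Formalization: The formal statement additionally assumes that, for every s in (0,1), the function x ↦ {∫_Ω |f(x)-f(y)|^q/(U(x,y)ρ(x,y)^{sq}) dμ(y)}^{1/q} is μ-measurable on Ω; without this its Y(Ω)-norm is undefined, or infinite in some examples. *)

theory Defs
  imports "HOL-Analysis.Analysis"
begin

text \<open>The underlying set is \<open>space M\<close>. Scalars \<open>'k\<close> range over the class \<^class>\<open>real_normed_field\<close>,
  whose only instances are, up to isomorphism, the real and the complex numbers.\<close>

definition quasi_metric_on :: "'a set \<Rightarrow> ('a \<Rightarrow> 'a \<Rightarrow> real) \<Rightarrow> bool" where
  "quasi_metric_on X \<rho> \<longleftrightarrow> X \<noteq> {} \<and>
     (\<forall>x\<in>X. \<forall>y\<in>X. 0 \<le> \<rho> x y \<and> (\<rho> x y = 0 \<longleftrightarrow> x = y) \<and> \<rho> x y = \<rho> y x) \<and>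
     (\<exists>K\<^sub>0\<ge>1. \<forall>x\<in>X. \<forall>y\<in>X. \<forall>z\<in>X. \<rho> x z \<le> K\<^sub>0 * (\<rho> x y + \<rho> y z))"

definition qball :: "'a measure \<Rightarrow> ('a \<Rightarrow> 'a \<Rightarrow> real) \<Rightarrow> 'a \<Rightarrow> real \<Rightarrow> 'a set" where
  "qball M \<rho> x r = {y \<in> space M. \<rho> x y < r}"

definition quasi_metric_measure_space :: "'a measure \<Rightarrow> ('a \<Rightarrow> 'a \<Rightarrow> real) \<Rightarrow> bool" where
  "quasi_metric_measure_space M \<rho> \<longleftrightarrow>
     quasi_metric_on (space M) \<rho> \<and> (\<forall>x\<in>space M. \<forall>r>0. qball M \<rho> x r \<in> sets M)"

definition U_fun :: "'a measure \<Rightarrow> ('a \<Rightarrow> 'a \<Rightarrow> real) \<Rightarrow> 'a \<Rightarrow> 'a \<Rightarrow> ennreal" where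
  "U_fun M \<rho> x y = min (emeasure M (qball M \<rho> x (\<rho> x y))) (emeasure M (qball M \<rho> y (\<rho> x y)))"

text \<open>A function space is given by its quasi-norm \<open>nY\<close>, which is defined on all measurable functions
  with values in \<open>[0, \<infinity>]\<close>; the space consists of the functions of finite quasi-norm.\<close>

definition fun_space ::
  "'a measure \<Rightarrow> (('a \<Rightarrow> 'k::real_normed_field) \<Rightarrow> ennreal) \<Rightarrow> ('a \<Rightarrow> 'k) set" where
  "fun_space M nY = {f \<in> borel_measurable M. nY f < \<infinity>}"

text \<open>Functions are identified when equal almost everywhere, so definiteness of the quasi-norm holds
  up to null sets; that null functions have quasi-norm zero follows from homogeneity and the
  lattice property.\<close>

definition quasi_Banach_fun_space ::
  "'a measure \<Rightarrow> (('a \<Rightarrow> 'k::real_normed_field) \<Rightarrow> ennreal) \<Rightarrow> bool" where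
  "quasi_Banach_fun_space M nY \<longleftrightarrow>
     (\<forall>f\<in>fun_space M nY. \<forall>c. nY (\<lambda>x. c * f x) = ennreal (norm c) * nY f) \<and>
     (\<exists>C::real. \<forall>f\<in>fun_space M nY. \<forall>g\<in>fun_space M nY.
        nY (\<lambda>x. f x + g x) \<le> ennreal C * (nY f + nY g)) \<and>
     (\<forall>F::nat \<Rightarrow> 'a \<Rightarrow> 'k. (\<forall>n. F n \<in> fun_space M nY) \<longrightarrow>
        (\<forall>e>0. \<exists>N. \<forall>m\<ge>N. \<forall>n\<ge>N. nY (\<lambda>x. F m x - F n x) < ennreal e) \<longrightarrow>
        (\<exists>f\<in>fun_space M nY. (\<lambda>n. nY (\<lambda>x. F n x - f x)) \<longlonglongrightarrow> 0))"

definition ball_quasi_Banach_fun_space ::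
  "'a measure \<Rightarrow> ('a \<Rightarrow> 'a \<Rightarrow> real) \<Rightarrow> (('a \<Rightarrow> 'k::real_normed_field) \<Rightarrow> ennreal) \<Rightarrow> bool" where
  "ball_quasi_Banach_fun_space M \<rho> nY \<longleftrightarrow>
     quasi_Banach_fun_space M nY \<and>
     (\<forall>f\<in>borel_measurable M. nY f = 0 \<longrightarrow> (AE x in M. f x = 0)) \<and>
     (\<forall>f\<in>borel_measurable M. \<forall>g\<in>borel_measurable M.
        (AE x in M. norm (g x) \<le> norm (f x)) \<longrightarrow> nY g \<le> nY f) \<and>
     (\<forall>(u::nat \<Rightarrow> 'a \<Rightarrow> real) v. (\<forall>m. u m \<in> borel_measurable M) \<longrightarrow> v \<in> borel_measurable M \<longrightarrow>
        (AE x in M. 0 \<le> u 0 x \<and> incseq (\<lambda>m. u m x) \<and> (\<lambda>m. u m x) \<longlonglongrightarrow> v x) \<longrightarrow>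
        incseq (\<lambda>m. nY (\<lambda>x. of_real (u m x))) \<and>
        (\<lambda>m. nY (\<lambda>x. of_real (u m x))) \<longlonglongrightarrow> nY (\<lambda>x. of_real (v x))) \<and>
     (\<forall>x\<in>space M. \<forall>r>0. (indicator (qball M \<rho> x r) :: 'a \<Rightarrow> 'k) \<in> fun_space M nY)"

text \<open>The infimum over the empty set is \<open>\<infinity>\<close> in \<^typ>\<open>ennreal\<close>. In particular, functions on \<open>\<Omega>\<close> that
  are not measurable have norm \<open>\<infinity>\<close>.\<close>

definition restr_norm ::
  "'a measure \<Rightarrow> (('a \<Rightarrow> 'k::real_normed_field) \<Rightarrow> ennreal) \<Rightarrow> 'a set \<Rightarrow> ('a \<Rightarrow> 'k) \<Rightarrow> ennreal" where
  "restr_norm M nY \<Omega> f = (INF g \<in> {g \<in> fun_space M nY. \<forall>x\<in>\<Omega>. g x = f x}. nY g)"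

text \<open>Extension to \<open>[0, \<infinity>]\<close>-valued functions: values \<open>\<infinity>\<close> on a null set are irrelevant, and a function
  that is infinite on a non-null set has norm \<open>\<infinity>\<close>.\<close>

definition restr_norm_ext ::
  "'a measure \<Rightarrow> (('a \<Rightarrow> 'k::real_normed_field) \<Rightarrow> ennreal) \<Rightarrow> 'a set \<Rightarrow> ('a \<Rightarrow> ennreal) \<Rightarrow> ennreal" where
  "restr_norm_ext M nY \<Omega> F =
     (if AE x in M. x \<in> \<Omega> \<longrightarrow> F x < \<infinity> then restr_norm M nY \<Omega> (\<lambda>x. of_real (enn2real (F x))) else \<infinity>)"

definition enn_powr :: "ennreal \<Rightarrow> real \<Rightarrow> ennreal" where
  "enn_powr t p = (if t = \<infinity> then \<infinity> else ennreal (enn2real t powr p))"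

text \<open>In \<^typ>\<open>ennreal\<close>, \<open>c / 0 = \<infinity>\<close> for \<open>c > 0\<close>, \<open>0 / 0 = 0\<close>, and \<open>c / \<infinity> = 0\<close> for finite \<open>c\<close>, which
  settles the cases where \<^const>\<open>U_fun\<close> is \<open>0\<close> or \<open>\<infinity>\<close>.\<close>

definition W_integrand ::
  "'a measure \<Rightarrow> ('a \<Rightarrow> 'a \<Rightarrow> real) \<Rightarrow> real \<Rightarrow> real \<Rightarrow> ('a \<Rightarrow> 'k::real_normed_field) \<Rightarrow> 'a \<Rightarrow> 'a \<Rightarrow> ennreal" where
  "W_integrand M \<rho> s q f x y =
     (if y = x then 0
      else ennreal (norm (f x - f y) powr q) / (U_fun M \<rho> x y * ennreal (\<rho> x y powr (s * q))))"

definition W_fun ::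
  "'a measure \<Rightarrow> ('a \<Rightarrow> 'a \<Rightarrow> real) \<Rightarrow> 'a set \<Rightarrow> real \<Rightarrow> real \<Rightarrow> ('a \<Rightarrow> 'k::real_normed_field) \<Rightarrow> 'a \<Rightarrow> ennreal" where
  "W_fun M \<rho> \<Omega> s q f x = enn_powr (\<integral>\<^sup>+y\<in>\<Omega>. W_integrand M \<rho> s q f x y \<partial>M) (1 / q)"

definition W_norm ::
  "'a measure \<Rightarrow> ('a \<Rightarrow> 'a \<Rightarrow> real) \<Rightarrow> (('a \<Rightarrow> 'k::real_normed_field) \<Rightarrow> ennreal) \<Rightarrow> 'a set \<Rightarrow>
     real \<Rightarrow> real \<Rightarrow> ('a \<Rightarrow> 'k) \<Rightarrow> ennreal" where
  "W_norm M \<rho> nY \<Omega> s q f = restr_norm_ext M nY \<Omega> (W_fun M \<rho> \<Omega> s q f)"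

definition W_space ::
  "'a measure \<Rightarrow> ('a \<Rightarrow> 'a \<Rightarrow> real) \<Rightarrow> (('a \<Rightarrow> 'k::real_normed_field) \<Rightarrow> ennreal) \<Rightarrow> 'a set \<Rightarrow>
     real \<Rightarrow> real \<Rightarrow> ('a \<Rightarrow> 'k) set" where
  "W_space M \<rho> nY \<Omega> s q =
     {f \<in> borel_measurable (restrict_space M \<Omega>). W_norm M \<rho> nY \<Omega> s q f < \<infinity>}"

end

theory Submission
  imports Defs
begin

text \<open>On a bounded set the Gagliardo-type seminorms are ordered: if all distances in \<open>\<Omega>\<close> are at most
  \<open>R\<close> and \<open>s \<le> t\<close>, then \<open>\<rho> powr (t * q) \<le> R powr ((t - s) * q) * \<rho> powr (s * q)\<close>, so that the kernel
  of order \<open>s\<close> is at most \<open>R powr ((t - s) * q)\<close> times the kernel of order \<open>t\<close>. Integration and the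
  lattice property of the quasi-norm turn this into
  \<open>W_norm s \<le> R powr (t - s) * W_norm t\<close> (lemma \<open>W_norm_mono_order\<close>). Hence a function of finite
  seminorm for one order \<open>t\<close> has seminorms bounded uniformly in \<open>s \<in> (0, t)\<close>, and the factor
  \<open>s powr (1 / q)\<close> drives the product to \<open>0\<close>.

  The function \<open>y \<mapsto> \<mu>(B(y, \<rho>(x, y)))\<close> inside the kernel need not be measurable, so the
  integral over \<open>\<Omega>\<close> is a lower integral; only its monotonicity and its homogeneity under finite
  constants are available, and these suffice.\<close>

section \<open>Scaling of extended nonnegative reals and lower integrals\<close>

lemma ennreal_inverse_antimono:
  fixes a b :: ennreal
  shows "a \<le> b \<Longrightarrow> inverse b \<le> inverse a"
  including ennreal.lifting
  by transfer (rule ereal_inverse_antimono)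

lemma ennreal_mult_inverse_self:
  fixes c :: ennreal
  shows "0 < c \<Longrightarrow> c < top \<Longrightarrow> c * inverse c = 1"
  using ennreal_divide_self[of c] by (simp only: divide_ennreal_def less_top)

lemma ennreal_divide_le_scaled_divide:
  fixes a u v c :: ennreal
  assumes c: "0 < c" "c < top" and vu: "v \<le> c * u"
  shows "a / u \<le> c * (a / v)"
proof -
  have "inverse c * inverse u = inverse (c * u)"
    using c by (simp add: ennreal_inverse_mult')
  also have "\<dots> \<le> inverse v"
    using vu by (rule ennreal_inverse_antimono)
  finally have "c * (inverse c * inverse u) \<le> c * inverse v"
    by (rule mult_left_mono) simp
  moreover have "c * inverse c = 1"
    using c by (rule ennreal_mult_inverse_self)
  ultimately have "inverse u \<le> c * inverse v"
    by (simp flip: mult.assoc)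
  then have "a * inverse u \<le> a * (c * inverse v)"
    by (rule mult_left_mono) simp
  then show ?thesis
    by (simp add: divide_ennreal_def ac_simps)
qed

text \<open>Without measurability of \<open>f\<close>, homogeneity comes from the definition of the integral as a
  supremum: division by \<open>c\<close> maps the simple functions below \<open>c * f\<close> to simple functions below \<open>f\<close>.\<close>

lemma nn_integral_cmult_le_nonmeasurable:
  fixes f :: "'a \<Rightarrow> ennreal"
  assumes c: "0 < c" "c < top"
  shows "(\<integral>\<^sup>+ x. c * f x \<partial>M) \<le> c * (\<integral>\<^sup>+ x. f x \<partial>M)"
proof -
  have "integral\<^sup>S M g \<le> c * integral\<^sup>N M f"
    if g: "simple_function M g" "g \<le> (\<lambda>x. c * f x)" for g
  proof -
    have cc: "c * inverse c = 1"
      using c by (rule ennreal_mult_inverse_self)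
    have "inverse c * g x \<le> f x" for x
    proof -
      have "inverse c * g x \<le> inverse c * (c * f x)"
        using g(2) by (intro mult_left_mono) (auto simp: le_fun_def)
      also have "\<dots> = f x"
        using cc by (metis mult.assoc mult.commute mult.left_neutral)
      finally show ?thesis .
    qed
    then have "(\<integral>\<^sup>+ x. inverse c * g x \<partial>M) \<le> integral\<^sup>N M f"
      by (intro nn_integral_mono)
    then have "inverse c * integral\<^sup>S M g \<le> integral\<^sup>N M f"
      using g(1)
      by (simp add: nn_integral_cmult borel_measurable_simple_function nn_integral_eq_simple_integral)
    then have "c * (inverse c * integral\<^sup>S M g) \<le> c * integral\<^sup>N M f"
      by (rule mult_left_mono) simp
    then show ?thesis
      using cc by (simp flip: mult.assoc)
  qed
  then show ?thesis
    unfolding nn_integral_def[of M "\<lambda>x. c * f x"] by (auto intro: SUP_least)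
qed

lemma enn_powr_mono:
  assumes "a \<le> b" "0 \<le> p"
  shows "enn_powr a p \<le> enn_powr b p"
proof (cases "b = \<infinity>")
  case False
  then have "a \<noteq> \<infinity>" "enn2real a \<le> enn2real b"
    using assms by (auto simp: top_unique less_top intro!: enn2real_mono)
  then show ?thesis
    using False assms by (auto simp: enn_powr_def intro!: ennreal_leI powr_mono2)
qed (simp add: enn_powr_def)

lemma enn_powr_cmult:
  assumes "0 < c"
  shows "enn_powr (ennreal c * a) p = ennreal (c powr p) * enn_powr a p"
  using assms
  by (cases a) (auto simp: enn_powr_def ennreal_mult_top powr_mult simp flip: ennreal_mult)

section \<open>Domination in the restricted space\<close>

text \<open>The lattice property and homogeneity pass from \<open>nY\<close> to its restriction: an extension \<open>g\<close>
  of \<open>G\<close> to the whole space dominates, after multiplication by \<open>c\<close>, the extension of \<open>F\<close> by zero.\<close>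

lemma restr_norm_ext_le_cmult:
  fixes nY :: "('a \<Rightarrow> 'k::{real_normed_field, second_countable_topology}) \<Rightarrow> ennreal"
  assumes Y: "ball_quasi_Banach_fun_space M \<rho> nY"
    and \<Omega>: "\<Omega> \<in> sets M"
    and F: "F \<in> borel_measurable (restrict_space M \<Omega>)"
    and c: "0 < c"
    and le: "\<And>x. x \<in> \<Omega> \<Longrightarrow> F x \<le> ennreal c * G x"
  shows "restr_norm_ext M nY \<Omega> F \<le> ennreal c * restr_norm_ext M nY \<Omega> G"
proof (cases "AE x in M. x \<in> \<Omega> \<longrightarrow> G x < \<infinity>")
  case False
  then show ?thesis
    using c by (simp add: restr_norm_ext_def ennreal_mult_top)
next
  case True
  have Ffin: "AE x in M. x \<in> \<Omega> \<longrightarrow> F x < \<infinity>"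
    using True
  proof eventually_elim
    case (elim x)
    then show ?case
      using le[of x] by (auto simp: ennreal_mult_less_top intro: le_less_trans)
  qed
  define h :: "'a \<Rightarrow> 'k" where "h = (\<lambda>x. of_real (indicator \<Omega> x * enn2real (F x)))"
  have h_meas: "h \<in> borel_measurable M"
  proof -
    have "(\<lambda>x. enn2real (F x)) \<in> borel_measurable (restrict_space M \<Omega>)"
      using F by measurable
    then have "(\<lambda>x. indicator \<Omega> x * enn2real (F x)) \<in> borel_measurable M"
      using \<Omega> by (subst (asm) borel_measurable_restrict_space_iff) auto
    then show ?thesis
      unfolding h_def by measurable
  qed
  have hom: "nY (\<lambda>x. b * g x) = ennreal (norm b) * nY g" if "g \<in> fun_space M nY" for b g
    using Y that unfolding ball_quasi_Banach_fun_space_def quasi_Banach_fun_space_def by blast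
  have lattice: "nY g \<le> nY g'" if "g \<in> borel_measurable M" "g' \<in> borel_measurable M"
    "AE x in M. norm (g x) \<le> norm (g' x)" for g g'
    using Y that unfolding ball_quasi_Banach_fun_space_def by blast
  have "restr_norm M nY \<Omega> (\<lambda>x. of_real (enn2real (F x))) \<le> ennreal c * nY g"
    if g: "g \<in> fun_space M nY" "\<forall>x\<in>\<Omega>. g x = of_real (enn2real (G x))" for g
  proof -
    have gm: "g \<in> borel_measurable M" and gfin: "nY g < \<infinity>"
      using g(1) by (auto simp: fun_space_def)
    \<comment> \<open>Where \<open>G\<close> is infinite, \<open>enn2real\<close> makes \<open>g\<close> vanish, so the domination can fail on a null set.\<close>
    have "AE x in M. norm (h x) \<le> norm (of_real c * g x)"
      using True
    proof eventually_elim
      case (elim x)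
      show ?case
      proof (cases "x \<in> \<Omega>")
        case True
        then have "enn2real (F x) \<le> enn2real (ennreal c * G x)"
          using le[of x] elim by (intro enn2real_mono) (auto simp: ennreal_mult_less_top)
        then show ?thesis
          using True g(2) c by (simp add: h_def norm_mult enn2real_mult)
      qed (simp add: h_def)
    qed
    then have "nY h \<le> nY (\<lambda>x. of_real c * g x)"
      using gm by (intro lattice h_meas) measurable
    also have "\<dots> = ennreal c * nY g"
      using hom[OF g(1)] c by simp
    finally have hle: "nY h \<le> ennreal c * nY g" .
    also have "\<dots> < \<infinity>"
      using gfin by (simp add: ennreal_mult_less_top)
    finally have "h \<in> fun_space M nY"
      using h_meas by (simp add: fun_space_def)
    then have "restr_norm M nY \<Omega> (\<lambda>x. of_real (enn2real (F x))) \<le> nY h"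
      unfolding restr_norm_def by (intro INF_lower) (simp add: h_def)
    with hle show ?thesis by (rule order_trans[rotated])
  qed
  \<comment> \<open>Dividing by \<open>c\<close> leaves a bare infimum on the right, over which the bounds can be collected.\<close>
  then have "restr_norm M nY \<Omega> (\<lambda>x. of_real (enn2real (F x))) / ennreal c
      \<le> restr_norm M nY \<Omega> (\<lambda>x. of_real (enn2real (G x)) :: 'k)"
    unfolding restr_norm_def[of M nY \<Omega> "\<lambda>x. of_real (enn2real (G x))"]
    using c by (intro INF_greatest divide_le_posI_ennreal) auto
  then have "ennreal c * (restr_norm M nY \<Omega> (\<lambda>x. of_real (enn2real (F x))) / ennreal c)
      \<le> ennreal c * restr_norm M nY \<Omega> (\<lambda>x. of_real (enn2real (G x)) :: 'k)"
    by (rule mult_left_mono) simp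
  then show ?thesis
    using True Ffin c
    by (simp add: restr_norm_ext_def ennreal_times_divide mult.commute[of "ennreal c"] ennreal_mult_divide_eq)
qed

section \<open>Comparison of the seminorms of two orders\<close>

text \<open>The weight \<open>U_fun\<close> may be \<open>0\<close> or \<open>\<infinity>\<close>, so the comparison of the powers of \<open>\<rho> x y\<close> is made in
  the denominators, where multiplication by \<open>U_fun\<close> is monotone, before passing to quotients.\<close>

lemma W_integrand_mono_order:
  assumes qm: "quasi_metric_on (space M) \<rho>"
    and xy: "x \<in> space M" "y \<in> space M"
    and R: "0 < R" "\<rho> x y \<le> R" and st: "s \<le> t" and q: "0 < q"
  shows "W_integrand M \<rho> s q f x y \<le> ennreal (R powr ((t - s) * q)) * W_integrand M \<rho> t q f x y"
proof (cases "y = x")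
  case False
  let ?r = "\<rho> x y" and ?C = "R powr ((t - s) * q)"
  have "0 \<le> ?r" "?r \<noteq> 0"
    using qm xy False by (auto simp: quasi_metric_on_def)
  then have r: "0 < ?r" by simp
  have "?r powr (t * q) = ?r powr ((t - s) * q) * ?r powr (s * q)"
    by (simp add: left_diff_distrib flip: powr_add)
  also have "\<dots> \<le> ?C * ?r powr (s * q)"
    using r R st q by (intro mult_right_mono powr_mono2) auto
  finally have "ennreal (?r powr (t * q)) \<le> ennreal ?C * ennreal (?r powr (s * q))"
    by (simp add: ennreal_leI flip: ennreal_mult)
  then have "U_fun M \<rho> x y * ennreal (?r powr (t * q))
      \<le> U_fun M \<rho> x y * (ennreal ?C * ennreal (?r powr (s * q)))"
    by (rule mult_left_mono) simp
  then have "U_fun M \<rho> x y * ennreal (?r powr (t * q))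
      \<le> ennreal ?C * (U_fun M \<rho> x y * ennreal (?r powr (s * q)))"
    by (simp add: ac_simps)
  then show ?thesis
    using False R(1) by (simp add: W_integrand_def ennreal_divide_le_scaled_divide)
qed (simp add: W_integrand_def)

lemma W_fun_mono_order:
  assumes qm: "quasi_metric_on (space M) \<rho>"
    and \<Omega>: "\<Omega> \<subseteq> space M" and x: "x \<in> \<Omega>"
    and R: "0 < R" "\<And>y. y \<in> \<Omega> \<Longrightarrow> \<rho> x y \<le> R" and st: "s \<le> t" and q: "0 < q"
  shows "W_fun M \<rho> \<Omega> s q f x \<le> ennreal (R powr (t - s)) * W_fun M \<rho> \<Omega> t q f x"
proof -
  let ?C = "R powr ((t - s) * q)"
  let ?I = "\<lambda>s. \<integral>\<^sup>+y\<in>\<Omega>. W_integrand M \<rho> s q f x y \<partial>M"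
  have "W_integrand M \<rho> s q f x y * indicator \<Omega> y
      \<le> ennreal ?C * (W_integrand M \<rho> t q f x y * indicator \<Omega> y)" for y
    using W_integrand_mono_order[OF qm, of x y R s t q f] assms
    by (auto simp: indicator_def)
  then have "?I s \<le> (\<integral>\<^sup>+y. ennreal ?C * (W_integrand M \<rho> t q f x y * indicator \<Omega> y) \<partial>M)"
    by (intro nn_integral_mono)
  also have "\<dots> \<le> ennreal ?C * ?I t"
    using R(1) by (intro nn_integral_cmult_le_nonmeasurable) auto
  finally have "enn_powr (?I s) (1 / q) \<le> enn_powr (ennreal ?C * ?I t) (1 / q)"
    using q by (intro enn_powr_mono) auto
  also have "\<dots> = ennreal (?C powr (1 / q)) * enn_powr (?I t) (1 / q)"
    using R(1) by (simp add: enn_powr_cmult)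
  also have "?C powr (1 / q) = R powr (t - s)"
    using q by (simp add: powr_powr)
  finally show ?thesis
    by (simp add: W_fun_def)
qed

lemma W_norm_mono_order:
  fixes nY :: "('a \<Rightarrow> 'k::{real_normed_field, second_countable_topology}) \<Rightarrow> ennreal"
  assumes "quasi_metric_on (space M) \<rho>"
    and "ball_quasi_Banach_fun_space M \<rho> nY"
    and "\<Omega> \<in> sets M"
    and "0 < R" "\<And>x y. x \<in> \<Omega> \<Longrightarrow> y \<in> \<Omega> \<Longrightarrow> \<rho> x y \<le> R"
    and "s \<le> t" "0 < q"
    and "W_fun M \<rho> \<Omega> s q f \<in> borel_measurable (restrict_space M \<Omega>)"
  shows "W_norm M \<rho> nY \<Omega> s q f \<le> ennreal (R powr (t - s)) * W_norm M \<rho> nY \<Omega> t q f"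
  unfolding W_norm_def
  using assms by (intro restr_norm_ext_le_cmult W_fun_mono_order) (auto dest: sets.sets_into_space)

section \<open>Vanishing of the scaled seminorm\<close>

theorem theorem1p1:
  fixes M :: "'a measure" and \<rho> :: "'a \<Rightarrow> 'a \<Rightarrow> real"
    and nY :: "('a \<Rightarrow> 'k::{real_normed_field, second_countable_topology}) \<Rightarrow> ennreal"
    and \<Omega> :: "'a set" and q :: real and f :: "'a \<Rightarrow> 'k"
  assumes "0 < q"
    and "quasi_metric_measure_space M \<rho>"
    and "\<Omega> \<in> sets M"
    and "bdd_above {\<rho> x y | x y. x \<in> \<Omega> \<and> y \<in> \<Omega>}"
    and "ball_quasi_Banach_fun_space M \<rho> nY"
    and "f \<in> (\<Union>s\<in>{0<..<1}. W_space M \<rho> nY \<Omega> s q)"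
    \<comment> \<open>the norms below are those of elements of \<open>\<M>(\<Omega>)\<close>\<close>
    and "\<forall>s\<in>{0<..<1}. W_fun M \<rho> \<Omega> s q f \<in> borel_measurable (restrict_space M \<Omega>)"
  shows "((\<lambda>s. ennreal (s powr (1 / q)) * W_norm M \<rho> nY \<Omega> s q f) \<longlongrightarrow> 0) (at_right 0)"
proof -
  obtain t where t: "0 < t" "t < 1" and fin: "W_norm M \<rho> nY \<Omega> t q f < \<infinity>"
    using assms(6) by (auto simp: W_space_def)
  obtain R0 where R0: "\<And>x y. x \<in> \<Omega> \<Longrightarrow> y \<in> \<Omega> \<Longrightarrow> \<rho> x y \<le> R0"
    using assms(4) unfolding bdd_above_def by blast
  \<comment> \<open>With \<open>R \<ge> 1\<close>, the factor \<open>R powr (t - s)\<close> is bounded by \<open>R powr t\<close> for all \<open>s > 0\<close>.\<close>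
  define R where "R = max 1 R0"
  define K where "K = ennreal (R powr t) * W_norm M \<rho> nY \<Omega> t q f"
  have K: "K < \<infinity>"
    using fin by (simp add: K_def ennreal_mult_less_top)
  have bound: "W_norm M \<rho> nY \<Omega> s q f \<le> K" if s: "0 < s" "s < t" for s
  proof -
    have "W_norm M \<rho> nY \<Omega> s q f \<le> ennreal (R powr (t - s)) * W_norm M \<rho> nY \<Omega> t q f"
      using assms s t R0
      by (intro W_norm_mono_order) (auto simp: quasi_metric_measure_space_def R_def le_max_iff_disj)
    also have "\<dots> \<le> K"
      unfolding K_def using s
      by (intro mult_right_mono ennreal_leI powr_mono) (auto simp: R_def)
    finally show ?thesis .
  qed
  have "((\<lambda>s::real. s powr (1 / q)) \<longlongrightarrow> 0 powr (1 / q)) (at_right 0)"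
    using assms(1)
    by (intro tendsto_powr2 tendsto_intros) (auto simp: eventually_at_right_less intro: eventually_at_rightI[of 0 1])
  then have "((\<lambda>s::real. ennreal (s powr (1 / q))) \<longlongrightarrow> ennreal 0) (at_right 0)"
    by (intro tendsto_ennrealI) simp
  then have "((\<lambda>s::real. K * ennreal (s powr (1 / q))) \<longlongrightarrow> K * ennreal 0) (at_right 0)"
    using K by (intro ennreal_tendsto_cmult) auto
  then have lim: "((\<lambda>s::real. ennreal (s powr (1 / q)) * K) \<longlongrightarrow> 0) (at_right 0)"
    by (simp add: mult.commute)
  have "eventually (\<lambda>s. ennreal (s powr (1 / q)) * W_norm M \<rho> nY \<Omega> s q f
      \<le> ennreal (s powr (1 / q)) * K) (at_right 0)"
    using t bound by (intro eventually_at_rightI[of 0 t]) (auto intro: mult_left_mono)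
  then show ?thesis
    by (intro tendsto_sandwich[OF _ _ tendsto_const lim]) auto
qed

end
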